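(* Let $K$ be a non-trivial (additively) idempotent semiring. Then $a\mapsto\overline a^0$ is a faithful involutive category representation of $\mathcal{TL}$ in $\mathcal M(K)$. In particular, for each $n\ge1$ this yields a faithful involutive representation of the monoid $\mathcal{TL}_n$ by $2^{n-1}\times2^{n-1}$ matrices over $K$.
   Context: **Temperley–Lieb category.** $\mathbb N=\{0,1,2,\ldots\}$, $[n]=\{1,\ldots,n\}$. For $A\subseteq\mathbb N$, $A'$ and $A''$ are disjoint copies of $A$. $\mathcal{TL}_{m,n}$ is the set of all set partitions $a$ of $[m]\cup[n]'$ in which every block has size $2$ and which are planar: the graph with edges the blocks can be drawn without crossings with vertex $x\in[m]$ at $(x,1)$, $x'\in[n]'$ at $(x,0)$ and all edges inside the strip $0\le y\le1$. The elements of $a$ are called $a$-blocks. For $a\in\mathcal{TL}_{m,n}$, $b\in\mathcal{TL}_{n,t}$, the product graph $\Pi(a,b)$ has vertex set $[m]\cup[n]''\cup[t]'$ and edges those of $a$ (lower vertices $x'$ renamed $x''$) and of $b$ (upper vertices $x$ renamed $x''$); $ab\in\mathcal{TL}_{m,t}$ is the partition in which $x,y\in[m]\cup[t]'$ are in the same block iff they are in the same component of $\Pi(a,b)$. The category $\mathcal{TL}$ has objects $\mathbb N$, hom-sets $\mathcal{TL}_{m,n}$, this composition, identities $\iota_n=\{\{i,i'\}:i\in[n]\}$, and involution $a\mapsto a^*$ swapping $i\leftrightarrow i'$. $\mathcal{TL}_n=\mathcal{TL}_{n,n}$ is the endomorphism monoid at $n$. **Matrices.** A semiring $(K,+,\cdot,0,1)$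 has $(K,+,0)$ a commutative monoid, $(K,\cdot,1)$ a monoid, distributivity, and $0$ a multiplicative zero; non-trivial means $0\ne1$; idempotent means $1+1=1$. $\mathcal M(K)$ is the category with object set $\mathbb N$, hom-sets the sets of $m\times n$ matrices over $K$, composition matrix multiplication, involution transpose. For $a\in\mathcal{TL}_{m,n}$, $\overline a$ is the $2^m\times2^n$ matrix over $K$, with rows and columns indexed by the subsets of $[m]$ and $[n]$ (in some fixed order), with $\overline a_{X,Y}=1$ if $X\cup Y'$ is a (possibly empty) union of $a$-blocks, and $0$ otherwise. $\overline a^0$ is the submatrix of $\overline a$ on the rows and columns indexed by subsets of even cardinality. **Representations.** A category representation is a functor; it is faithful if it is injective on objects and morphisms, and involutive if it preserves the involutions. A representation of a monoid is a monoid morphism; it is faithful if injective, and involutive if it preserves the involutions.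
   Formalization: Faithfulness fails literally: objects 0 and 1 both go to 1, and ι₀, ι₁ both go to the 1×1 matrix (1). The formal theorem proves this is the only collision, and that the representation is faithful on every full subcategory omitting 0 or 1; it is a functor preserving involution on all of TL. *)

theory Defs
  imports
    "HOL-Analysis.Analysis"
    "HOL-Library.Disjoint_Sets"
    "Jordan_Normal_Form.DL_Submatrix"
begin

section \<open>Involutive categories and their representations\<close>

text \<open>Morphisms are indexed by their hom-sets, so composition receives the three objects and an
  arrow map receives the two objects involved.\<close>

record ('o, 'm) inv_cat =
  objects :: "'o set"
  arrows :: "'o \<Rightarrow> 'o \<Rightarrow> 'm set"
  compose :: "'o \<Rightarrow> 'o \<Rightarrow> 'o \<Rightarrow> 'm \<Rightarrow> 'm \<Rightarrow> 'm"
  ident :: "'o \<Rightarrow> 'm"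
  involution :: "'m \<Rightarrow> 'm"

definition full_subcat :: "('o, 'm) inv_cat \<Rightarrow> 'o set \<Rightarrow> ('o, 'm) inv_cat" where
  "full_subcat C S = C\<lparr>objects := objects C \<inter> S\<rparr>"

definition cat_representation ::
  "('o, 'm) inv_cat \<Rightarrow> ('p, 'k) inv_cat \<Rightarrow> ('o \<Rightarrow> 'p) \<Rightarrow> ('o \<Rightarrow> 'o \<Rightarrow> 'm \<Rightarrow> 'k) \<Rightarrow> bool" where
  "cat_representation C D Fo Fm \<longleftrightarrow>
     (\<forall>x \<in> objects C. Fo x \<in> objects D) \<and>
     (\<forall>x \<in> objects C. \<forall>y \<in> objects C. \<forall>f \<in> arrows C x y. Fm x y f \<in> arrows D (Fo x) (Fo y)) \<and>
     (\<forall>x \<in> objects C. Fm x x (ident C x) = ident D (Fo x)) \<and>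
     (\<forall>x \<in> objects C. \<forall>y \<in> objects C. \<forall>z \<in> objects C. \<forall>f \<in> arrows C x y. \<forall>g \<in> arrows C y z.
        Fm x z (compose C x y z f g) = compose D (Fo x) (Fo y) (Fo z) (Fm x y f) (Fm y z g))"

definition involutive_rep ::
  "('o, 'm) inv_cat \<Rightarrow> ('p, 'k) inv_cat \<Rightarrow> ('o \<Rightarrow> 'o \<Rightarrow> 'm \<Rightarrow> 'k) \<Rightarrow> bool" where
  "involutive_rep C D Fm \<longleftrightarrow>
     (\<forall>x \<in> objects C. \<forall>y \<in> objects C. \<forall>f \<in> arrows C x y.
        Fm y x (involution C f) = involution D (Fm x y f))"

text \<open>Injectivity on morphisms is required across different hom-sets as well.\<close>

definition faithful_rep ::
  "('o, 'm) inv_cat \<Rightarrow> ('o \<Rightarrow> 'p) \<Rightarrow> ('o \<Rightarrow> 'o \<Rightarrow> 'm \<Rightarrow> 'k) \<Rightarrow> bool" where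
  "faithful_rep C Fo Fm \<longleftrightarrow>
     inj_on Fo (objects C) \<and>
     inj_on (\<lambda>(x, y, f). Fm x y f)
       {(x, y, f). x \<in> objects C \<and> y \<in> objects C \<and> f \<in> arrows C x y}"


section \<open>The Temperley--Lieb category\<close>

text \<open>\<open>Upper x\<close>, \<open>Lower x\<close> and \<open>Middle x\<close> stand for \<open>x\<close>, \<open>x'\<close> and \<open>x''\<close>; middle vertices occur
  only in product graphs.\<close>

datatype vertex = Upper nat | Lower nat | Middle nat

type_synonym diagram = "vertex set set"

definition verts :: "nat \<Rightarrow> nat \<Rightarrow> vertex set" where
  "verts m n = Upper ` {1..m} \<union> Lower ` {1..n}"

primrec (nonexhaustive) position :: "vertex \<Rightarrow> real \<times> real" where
  "position (Upper x) = (real x, 1)"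
| "position (Lower x) = (real x, 0)"

text \<open>A drawing assigns to each edge a simple arc in the strip joining its end points. Distinct
  blocks share no vertex, so absence of crossings means that their arcs are disjoint.\<close>

definition planar :: "diagram \<Rightarrow> bool" where
  "planar a \<longleftrightarrow>
     (\<exists>\<gamma> :: vertex set \<Rightarrow> real \<Rightarrow> real \<times> real.
        (\<forall>B \<in> a. arc (\<gamma> B) \<and> path_image (\<gamma> B) \<subseteq> UNIV \<times> {0..1} \<and>
                 {pathstart (\<gamma> B), pathfinish (\<gamma> B)} = position ` B) \<and>
        (\<forall>B \<in> a. \<forall>C \<in> a. B \<noteq> C \<longrightarrow> path_image (\<gamma> B) \<inter> path_image (\<gamma> C) = {}))"

definition TL :: "nat \<Rightarrow> nat \<Rightarrow> diagram set" where
  "TL m n = {a. partition_on (verts m n) a \<and> (\<forall>B \<in> a. card B = 2) \<and> planar a}"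

primrec lower_to_middle :: "vertex \<Rightarrow> vertex" where
  "lower_to_middle (Upper x) = Upper x"
| "lower_to_middle (Lower x) = Middle x"
| "lower_to_middle (Middle x) = Middle x"

primrec upper_to_middle :: "vertex \<Rightarrow> vertex" where
  "upper_to_middle (Upper x) = Middle x"
| "upper_to_middle (Lower x) = Lower x"
| "upper_to_middle (Middle x) = Middle x"

definition product_edges :: "diagram \<Rightarrow> diagram \<Rightarrow> vertex set set" where
  "product_edges a b = (`) lower_to_middle ` a \<union> (`) upper_to_middle ` b"

definition same_component :: "vertex set set \<Rightarrow> (vertex \<times> vertex) set" where
  "same_component E = {(u, v). {u, v} \<in> E}\<^sup>*"

definition TL_mult :: "nat \<Rightarrow> nat \<Rightarrow> diagram \<Rightarrow> diagram \<Rightarrow> diagram" where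
  "TL_mult m t a b =
     verts m t // (same_component (product_edges a b) \<inter> verts m t \<times> verts m t)"

definition TL_id :: "nat \<Rightarrow> diagram" where
  "TL_id n = {{Upper i, Lower i} | i. i \<in> {1..n}}"

primrec flip :: "vertex \<Rightarrow> vertex" where
  "flip (Upper x) = Lower x"
| "flip (Lower x) = Upper x"
| "flip (Middle x) = Middle x"

definition TL_star :: "diagram \<Rightarrow> diagram" where
  "TL_star a = (`) flip ` a"

definition TL_cat :: "(nat, diagram) inv_cat" where
  "TL_cat = \<lparr>objects = UNIV, arrows = TL, compose = (\<lambda>m n t. TL_mult m t),
             ident = TL_id, involution = TL_star\<rparr>"

definition TL_monoid :: "nat \<Rightarrow> diagram monoid" where
  "TL_monoid n = \<lparr>carrier = TL n n, mult = TL_mult n n, one = TL_id n\<rparr>"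


section \<open>Matrices\<close>

text \<open>The class \<open>semiring_1\<close> is that of non-trivial, not necessarily commutative semirings with
  identity.\<close>

definition mat_cat :: "(nat, 'k :: semiring_1 mat) inv_cat" where
  "mat_cat = \<lparr>objects = UNIV, arrows = carrier_mat, compose = (\<lambda>m n t. (*)),
              ident = one_mat, involution = transpose_mat\<rparr>"

text \<open>A choice of an order on the subsets of each \<open>[n]\<close>: \<open>e n i\<close> is the \<open>i\<close>-th subset, counting
  from 0.\<close>

definition subset_order :: "(nat \<Rightarrow> nat \<Rightarrow> nat set) \<Rightarrow> bool" where
  "subset_order e \<longleftrightarrow> (\<forall>n. bij_betw (e n) {..<2 ^ n} (Pow {1..n}))"

definition TL_mat ::
  "(nat \<Rightarrow> nat \<Rightarrow> nat set) \<Rightarrow> nat \<Rightarrow> nat \<Rightarrow> diagram \<Rightarrow> 'k :: semiring_1 mat" where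
  "TL_mat e m n a =
     mat (2 ^ m) (2 ^ n)
       (\<lambda>(i, j). if \<exists>C \<subseteq> a. Upper ` e m i \<union> Lower ` e n j = \<Union>C then 1 else 0)"

definition even_indices :: "(nat \<Rightarrow> nat \<Rightarrow> nat set) \<Rightarrow> nat \<Rightarrow> nat set" where
  "even_indices e n = {i. i < 2 ^ n \<and> even (card (e n i))}"

definition TL_even_mat ::
  "(nat \<Rightarrow> nat \<Rightarrow> nat set) \<Rightarrow> nat \<Rightarrow> nat \<Rightarrow> diagram \<Rightarrow> 'k :: semiring_1 mat" where
  "TL_even_mat e m n a = submatrix (TL_mat e m n a) (even_indices e m) (even_indices e n)"

text \<open>Pitfall: \<open>even_dim 0 = even_dim 1 = 1\<close>, and the identities at 0 and at 1 both have the
  1 by 1 identity matrix as their even matrix.\<close>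

definition even_dim :: "nat \<Rightarrow> nat" where
  "even_dim n = card {X. X \<subseteq> {1..n} \<and> even (card X)}"

end

theory Submission
  imports Defs
begin

text \<open>
  Call a set of vertices saturated if it is a union of blocks. The matrix of \<open>a\<close> records which sets
  \<open>X \<union> Y'\<close> are saturated, for \<open>X\<close> and \<open>Y\<close> of even size.

  Multiplicativity. A set \<open>X \<union> Y'\<close> is saturated for \<open>ab\<close> iff it extends by some set \<open>Z''\<close> of middle
  vertices to a union of components of the product graph, that is, iff some \<open>Z\<close> makes \<open>X \<union> Z'\<close>
  saturated for \<open>a\<close> and \<open>Z \<union> Y'\<close> saturated for \<open>b\<close> (\<open>block_union_TL_mult\<close>). An entry of the matrix
  product is a sum of ones over all such \<open>Z\<close>, and \<open>1 + 1 = 1\<close> turns this count into the existence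
  of \<open>Z\<close>. Restricting to even sets loses no \<open>Z\<close>: blocks have two elements, so \<open>|X| + |Z|\<close> is even
  as soon as \<open>X \<union> Z'\<close> is saturated (\<open>even_card_rows\<close>).

  Faithfulness. A block inside one row is itself an even saturated set, so the matrix shows it.
  What could be lost is how the remaining vertices are matched by transversals. If two diagrams
  with the same matrix match them differently, then comparing the even saturated sets made of two
  transversals yields two tops and two bottoms that are joined in one way by the first diagram and
  in the opposite way by the second (\<open>blocks_subset\<close>). One of the two ways must cross, and
  transversals of a planar diagram cannot cross (\<open>planar_transversals_order\<close>). This last fact is
  topological; it reduces to the theorem that a path from the left side to the right side of a
  rectangle meets every path from its bottom to its top.

  Hom-sets are told apart by the size of the matrix, which is \<open>2 ^ (m - 1)\<close> by \<open>2 ^ (n - 1)\<close>.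
  The exponent is 0 both for \<open>m = 0\<close> and for \<open>m = 1\<close>, because the empty set is the only even subset
  of \<open>{}\<close> and of \<open>{1}\<close>. As \<open>TL 0 1\<close> and \<open>TL 1 0\<close> are empty, the one collision this leaves is that of
  the identities at 0 and 1.
\<close>

section \<open>Crossing arcs in a strip\<close>

lemma closed_segment_coords:
  fixes p :: "real \<times> real"
  assumes "p \<in> closed_segment (a, b) (c, d)"
  shows "fst p \<in> closed_segment a c" "snd p \<in> closed_segment b d"
  using assms by (auto simp: closed_segment_def)

lemma horizontal_segment:
  fixes p :: "real \<times> real"
  assumes "p \<in> closed_segment (a, c) (b, c)" "a \<le> b"
  shows "snd p = c \<and> a \<le> fst p \<and> fst p \<le> b"
  using closed_segment_coords[OF assms(1)] assms(2) by (simp add: closed_segment_eq_real_ivl)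

lemma vertical_segment:
  fixes p :: "real \<times> real"
  assumes "p \<in> closed_segment (c, a) (c, b)"
  shows "fst p = c \<and> min a b \<le> snd p \<and> snd p \<le> max a b"
  using closed_segment_coords[OF assms(1)] by (auto simp: closed_segment_eq_real_ivl split: if_splits)

text \<open>The theorem on crossing paths in a rectangle lives in \<open>real ^ 2\<close>, whereas drawings of diagrams
  use pairs of reals; a coordinate change carries it over.\<close>

lemma paths_meet_in_box:
  fixes f g :: "real \<Rightarrow> real \<times> real"
  assumes "path f" "path g"
    and "path_image f \<subseteq> {l..r} \<times> {b..t}" "path_image g \<subseteq> {l..r} \<times> {b..t}"
    and "fst (pathstart f) = l" "fst (pathfinish f) = r"
    and "snd (pathstart g) = b" "snd (pathfinish g) = t"
  shows "path_image f \<inter> path_image g \<noteq> {}"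
proof -
  define V :: "real \<times> real \<Rightarrow> real ^ 2" where "V p = (\<chi> i. if i = 1 then fst p else snd p)" for p
  have V1: "vec_nth (V p) 1 = fst p" and V2: "vec_nth (V p) 2 = snd p" for p
    by (simp_all add: V_def)
  have cont: "continuous_on A V" for A
    unfolding V_def
  proof (intro continuous_on_vec_lambda)
    show "continuous_on A (\<lambda>p. if i = 1 then fst p else snd p)" for i :: 2
      by (cases "i = 1") (simp_all add: continuous_on_fst continuous_on_snd)
  qed
  have pf: "path (V \<circ> f)" "path (V \<circ> g)"
    using assms(1,2) cont by (auto intro: path_continuous_image)
  have box: "V ` ({l..r} \<times> {b..t}) \<subseteq> cbox (V (l, b)) (V (r, t))"
    by (auto simp: mem_box_cart forall_2 V1 V2)
  have imf: "path_image (V \<circ> f) \<subseteq> cbox (V (l, b)) (V (r, t))"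
    and img: "path_image (V \<circ> g) \<subseteq> cbox (V (l, b)) (V (r, t))"
    unfolding path_image_compose using assms(3,4) box by blast+
  obtain z where z: "z \<in> path_image (V \<circ> f)" "z \<in> path_image (V \<circ> g)"
    by (rule fashoda[OF pf imf img])
       (use assms in \<open>simp_all add: pathstart_compose pathfinish_compose V1 V2\<close>)
  then obtain p q where "p \<in> path_image f" "q \<in> path_image g" "V p = V q"
    unfolding path_image_compose by auto
  moreover have "p = q" using \<open>V p = V q\<close> by (metis V1 V2 prod_eqI)
  ultimately show ?thesis by blast
qed

text \<open>The ends of the two arcs lie inside the long sides of the strip. To apply the rectangle version,
  both arcs are prolonged outside the strip: \<open>f\<close> goes straight up and down from its ends and then
  turns to the left side and to the right side, while \<open>g\<close> goes straight on to the bottom and to the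
  top. As \<open>x < u\<close> and \<open>v < y\<close>, the turns of \<open>f\<close> lead away from \<open>g\<close>.\<close>

lemma strip_crossing:
  fixes f g :: "real \<Rightarrow> real \<times> real"
  assumes "path f" "path g"
    and f: "path_image f \<subseteq> UNIV \<times> {0..1}" and g: "path_image g \<subseteq> UNIV \<times> {0..1}"
    and fx: "pathstart f = (x, 1)" and fy: "pathfinish f = (y, 0)"
    and gu: "pathstart g = (u, 1)" and gv: "pathfinish g = (v, 0)"
    and "x < u" "v < y"
  shows "path_image f \<inter> path_image g \<noteq> {}"
proof
  assume disj: "path_image f \<inter> path_image g = {}"
  have "bounded (path_image f \<union> path_image g)"
    using assms(1,2) by (simp add: bounded_path_image)
  then obtain M where M: "\<And>p. p \<in> path_image f \<union> path_image g \<Longrightarrow> norm p \<le> M"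
    unfolding bounded_iff by blast
  have M: "\<bar>fst p\<bar> \<le> M" if "p \<in> path_image f \<union> path_image g" for p
    using M[OF that] norm_fst_le[of "fst p" "snd p"] by simp
  have ends: "(x, 1) \<in> path_image f" "(y, 0) \<in> path_image f"
      "(u, 1) \<in> path_image g" "(v, 0) \<in> path_image g"
    using fx fy gu gv pathstart_in_path_image pathfinish_in_path_image by metis+
  have bd: "\<bar>x\<bar> \<le> M" "\<bar>y\<bar> \<le> M" "\<bar>u\<bar> \<le> M" "\<bar>v\<bar> \<le> M"
    using M[of "(x, 1)"] M[of "(y, 0)"] M[of "(u, 1)"] M[of "(v, 0)"] ends by auto
  (* M bounds the horizontal extent of both arcs. The vertical pieces of g run to heights 3 and -2,
     past the heights 2 and -1 at which f turns. *)
  define F where "F = linepath (-M, 2) (x, 2) +++ linepath (x, 2) (x, 1) +++ f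
    +++ linepath (y, 0) (y, -1) +++ linepath (y, -1) (M, -1)"
  define G where "G = linepath (v, -2) (v, 0) +++ reversepath g +++ linepath (u, 1) (u, 3)"
  have F: "path_image F = closed_segment (-M, 2) (x, 2) \<union> closed_segment (x, 2) (x, 1)
      \<union> path_image f \<union> closed_segment (y, 0) (y, -1) \<union> closed_segment (y, -1) (M, -1)"
    unfolding F_def using fx fy by (simp add: path_image_join Un_assoc)
  have G: "path_image G = closed_segment (v, -2) (v, 0) \<union> path_image g
      \<union> closed_segment (u, 1) (u, 3)"
    unfolding G_def using gu gv by (simp add: path_image_join Un_assoc)
  have Fcases: "(snd p = 2 \<and> -M \<le> fst p \<and> fst p \<le> x) \<or> (fst p = x \<and> 1 \<le> snd p \<and> snd p \<le> 2)
      \<or> p \<in> path_image f \<or> (fst p = y \<and> -1 \<le> snd p \<and> snd p \<le> 0)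
      \<or> (snd p = -1 \<and> y \<le> fst p \<and> fst p \<le> M)" if "p \<in> path_image F" for p
    using that bd horizontal_segment[of p "-M" 2 x] vertical_segment[of p x 2 1]
      vertical_segment[of p y 0 "-1"] horizontal_segment[of p y "-1" M]
    unfolding F Un_iff by (elim disjE) simp_all
  have Gcases: "(fst p = v \<and> -2 \<le> snd p \<and> snd p \<le> 0) \<or> p \<in> path_image g
      \<or> (fst p = u \<and> 1 \<le> snd p \<and> snd p \<le> 3)" if "p \<in> path_image G" for p
    using that vertical_segment[of p v "-2" 0] vertical_segment[of p u 1 3]
    unfolding G Un_iff by (elim disjE) simp_all
  have fS: "0 \<le> snd p \<and> snd p \<le> 1" if "p \<in> path_image f" for p using f that by auto
  have gS: "0 \<le> snd p \<and> snd p \<le> 1" if "p \<in> path_image g" for p using g that by auto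
  have "path_image F \<inter> path_image G \<noteq> {}"
  proof (rule paths_meet_in_box[where l="-M" and r=M and b="-2" and t=3])
    show "path F" "path G" unfolding F_def G_def using assms by auto
    show "path_image F \<subseteq> {-M..M} \<times> {-2..3}"
    proof
      fix p assume p: "p \<in> path_image F"
      show "p \<in> {-M..M} \<times> {-2..3}"
        using Fcases[OF p] bd fS[of p] M[of p] by (cases p) auto
    qed
    show "path_image G \<subseteq> {-M..M} \<times> {-2..3}"
    proof
      fix p assume p: "p \<in> path_image G"
      show "p \<in> {-M..M} \<times> {-2..3}"
        using Gcases[OF p] bd gS[of p] M[of p] by (cases p) auto
    qed
  qed (simp_all add: F_def G_def)
  then obtain p where p: "p \<in> path_image F" "p \<in> path_image G" by blast
  (* Outside the strip the two extensions never meet, and an extension touches the strip only at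
     an end point of its own arc. *)
  show False
  proof (cases "p \<in> path_image f")
    case True
    then have "p \<notin> path_image g" using disj by blast
    with Gcases[OF p(2)] fS[OF True] have "p = (v, 0) \<or> p = (u, 1)" by (cases p) auto
    with ends \<open>p \<notin> path_image g\<close> show False by blast
  next
    case nf: False
    show False
    proof (cases "p \<in> path_image g")
      case True
      with Fcases[OF p(1)] gS[OF True] nf have "p = (x, 1) \<or> p = (y, 0)" by (cases p) auto
      with ends nf show False by blast
    next
      case False
      with nf Fcases[OF p(1)] Gcases[OF p(2)] \<open>x < u\<close> \<open>v < y\<close> show False by auto
    qed
  qed
qed

lemma planar_transversals_order:
  assumes "planar a" and xy: "{Upper x, Lower y} \<in> a" and uv: "{Upper u, Lower v} \<in> a"
    and "x < u"
  shows "y < v"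
proof (rule ccontr)
  assume "\<not> y < v"
  then have "v \<le> y" by simp
  obtain \<gamma> :: "vertex set \<Rightarrow> real \<Rightarrow> real \<times> real" where
    \<gamma>: "(\<forall>B \<in> a. arc (\<gamma> B) \<and> path_image (\<gamma> B) \<subseteq> UNIV \<times> {0..1} \<and>
         {pathstart (\<gamma> B), pathfinish (\<gamma> B)} = position ` B) \<and>
       (\<forall>B \<in> a. \<forall>C \<in> a. B \<noteq> C \<longrightarrow> path_image (\<gamma> B) \<inter> path_image (\<gamma> C) = {})"
    using \<open>planar a\<close> unfolding planar_def by (elim exE)
  note arcs = \<gamma>[THEN conjunct1, THEN bspec] and disj = \<gamma>[THEN conjunct2, rule_format]
  (* A drawing does not fix the direction of an arc; reversing it if needed makes it run downwards. *)
  have oriented: "\<exists>f. path f \<and> path_image f = path_image (\<gamma> {Upper p, Lower q}) \<and>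
      path_image f \<subseteq> UNIV \<times> {0..1} \<and> pathstart f = (real p, 1) \<and> pathfinish f = (real q, 0)"
    if "{Upper p, Lower q} \<in> a" for p q
  proof -
    let ?g = "\<gamma> {Upper p, Lower q}"
    have "path ?g" "path_image ?g \<subseteq> UNIV \<times> {0..1}"
        and se: "{pathstart ?g, pathfinish ?g} = {(real p, 1), (real q, 0)}"
      using arcs[OF that] by (auto dest: arc_imp_path)
    show ?thesis
    proof (cases "pathstart ?g = (real p, 1)")
      case True
      with se have "pathfinish ?g = (real q, 0)" by (auto simp: doubleton_eq_iff)
      with True \<open>path ?g\<close> \<open>path_image ?g \<subseteq> UNIV \<times> {0..1}\<close> show ?thesis by blast
    next
      case False
      with se have "pathstart ?g = (real q, 0)" "pathfinish ?g = (real p, 1)"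
        by (auto simp: doubleton_eq_iff)
      with \<open>path ?g\<close> \<open>path_image ?g \<subseteq> UNIV \<times> {0..1}\<close> show ?thesis
        by (intro exI[of _ "reversepath ?g"]) simp
    qed
  qed
  obtain f g where fg: "path f" "path_image f = path_image (\<gamma> {Upper x, Lower y})"
      "path_image f \<subseteq> UNIV \<times> {0..1}" "pathstart f = (real x, 1)" "pathfinish f = (real y, 0)"
      "path g" "path_image g = path_image (\<gamma> {Upper u, Lower v})"
      "path_image g \<subseteq> UNIV \<times> {0..1}" "pathstart g = (real u, 1)" "pathfinish g = (real v, 0)"
    using oriented[OF xy] oriented[OF uv] by blast
  have "path_image f \<inter> path_image g \<noteq> {}"
  proof (cases "v = y")
    case True
    then show ?thesis using fg pathfinish_in_path_image by (metis IntI empty_iff)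
  next
    case False
    with \<open>x < u\<close> \<open>v \<le> y\<close> have "real x < real u" "real v < real y" by simp_all
    with fg strip_crossing show ?thesis by metis
  qed
  then have "path_image (\<gamma> {Upper x, Lower y}) \<inter> path_image (\<gamma> {Upper u, Lower v}) \<noteq> {}"
    using fg by simp
  moreover have "{Upper x, Lower y} \<noteq> {Upper u, Lower v}"
    using \<open>x < u\<close> by (simp add: doubleton_eq_iff)
  ultimately show False using disj[OF xy uv] by simp
qed

section \<open>Unions of blocks\<close>

definition block_union :: "'a set set \<Rightarrow> 'a set \<Rightarrow> bool" where
  "block_union a U \<longleftrightarrow> (\<exists>C \<subseteq> a. U = \<Union>C)"

lemma block_unionI: "C \<subseteq> a \<Longrightarrow> U = \<Union>C \<Longrightarrow> block_union a U"
  unfolding block_union_def by (intro exI conjI)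

lemma block_unionE:
  assumes "block_union a U"
  obtains C where "C \<subseteq> a" "U = \<Union>C"
  using assms unfolding block_union_def by (elim exE conjE)

text \<open>For a partition, being a union of blocks means that no block is cut. In this form the condition
  can be checked block by block.\<close>

lemma block_union_partition:
  assumes "partition_on V a"
  shows "block_union a U \<longleftrightarrow> U \<subseteq> V \<and> (\<forall>B \<in> a. B \<subseteq> U \<or> B \<inter> U = {})"
proof
  assume "block_union a U"
  then obtain C where C: "C \<subseteq> a" "U = \<Union>C" by (rule block_unionE)
  have "B \<subseteq> U \<or> B \<inter> U = {}" if "B \<in> a" for B
    using C that partition_onD2[OF assms] unfolding pairwise_def disjnt_def by blast
  with C partition_onD1[OF assms] show "U \<subseteq> V \<and> (\<forall>B \<in> a. B \<subseteq> U \<or> B \<inter> U = {})" by blast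
next
  assume U: "U \<subseteq> V \<and> (\<forall>B \<in> a. B \<subseteq> U \<or> B \<inter> U = {})"
  have "U = \<Union>{B \<in> a. B \<subseteq> U}"
    using U partition_onD1[OF assms] by blast
  then show "block_union a U" by (intro block_unionI) auto
qed

lemma block_union_quotient:
  assumes "equiv V R"
  shows "block_union (V // R) U \<longleftrightarrow> U \<subseteq> V \<and> (\<forall>u \<in> U. \<forall>v. (u, v) \<in> R \<longrightarrow> v \<in> U)"
proof -
  have p: "partition_on V (V // R)" using assms by (rule partition_on_quotient)
  show ?thesis
    unfolding block_union_partition[OF p]
  proof (intro conj_cong refl iffI ballI allI impI)
    fix u v assume "U \<subseteq> V" and *: "\<forall>B \<in> V // R. B \<subseteq> U \<or> B \<inter> U = {}"
      and "u \<in> U" "(u, v) \<in> R"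
    then have "u \<in> V" by blast
    then have "u \<in> R `` {u}" "R `` {u} \<in> V // R"
      by (rule equiv_class_self[OF assms], rule quotientI)
    with *[THEN bspec, of "R `` {u}"] \<open>u \<in> U\<close> have "R `` {u} \<subseteq> U" by blast
    with \<open>(u, v) \<in> R\<close> show "v \<in> U" by blast
  next
    fix B assume "U \<subseteq> V" and *: "\<forall>u \<in> U. \<forall>v. (u, v) \<in> R \<longrightarrow> v \<in> U" and B: "B \<in> V // R"
    show "B \<subseteq> U \<or> B \<inter> U = {}"
    proof (cases "B \<inter> U = {}")
      case False
      then obtain u where "u \<in> B" "u \<in> U" by blast
      then have "(u, v) \<in> R" if "v \<in> B" for v
        using quotient_eq_iff[OF assms B B \<open>u \<in> B\<close> that] by simp
      with * \<open>u \<in> U\<close> show ?thesis by blast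
    qed simp
  qed
qed

lemma block_union_image:
  assumes "inj f"
  shows "block_union ((`) f ` a) (f ` U) \<longleftrightarrow> block_union a U"
proof
  assume "block_union ((`) f ` a) (f ` U)"
  then obtain D where "D \<subseteq> (`) f ` a" "f ` U = \<Union>D" by (rule block_unionE)
  then obtain C where "C \<subseteq> a" "f ` U = \<Union>((`) f ` C)" by (auto simp: subset_image_iff)
  then have "f ` U = f ` \<Union>C" by (simp add: image_Union)
  then have "U = \<Union>C" using assms by (simp add: inj_image_eq_iff)
  with \<open>C \<subseteq> a\<close> show "block_union a U" by (rule block_unionI)
next
  assume "block_union a U"
  then obtain C where "C \<subseteq> a" "U = \<Union>C" by (rule block_unionE)
  then have "(`) f ` C \<subseteq> (`) f ` a" "f ` U = \<Union>((`) f ` C)" by auto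
  then show "block_union ((`) f ` a) (f ` U)"
    by (rule block_unionI)
qed

lemma even_card_block_union:
  assumes "partition_on V a" "\<And>B. B \<in> a \<Longrightarrow> card B = 2" "block_union a U"
  shows "even (card U)"
proof -
  obtain C where C: "C \<subseteq> a" "U = \<Union>C" using assms(3) by (rule block_unionE)
  have "disjoint C" using partition_onD2[OF assms(1)] C(1) by (rule pairwise_subset)
  moreover have "finite B" if "B \<in> C" for B
  proof -
    have "card B = 2" using assms(2) C(1) that by blast
    then show ?thesis by (intro card_ge_0_finite) simp
  qed
  ultimately have "card U = sum card C" unfolding C(2) by (rule card_Union_disjoint)
  also have "\<dots> = sum (\<lambda>_. 2) C" using assms(2) C by (intro sum.cong) auto
  finally show ?thesis by simp
qed

lemma block_union_of_size_two:
  assumes "\<And>B. B \<in> a \<Longrightarrow> card B = 2" "block_union a {p, q}" "p \<noteq> q"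
  shows "{p, q} \<in> a"
proof -
  obtain C where C: "C \<subseteq> a" "{p, q} = \<Union>C" using assms(2) by (rule block_unionE)
  then obtain B where B: "B \<in> C" "p \<in> B" by blast
  then have "B \<subseteq> {p, q}" using C(2) by blast
  moreover have "card B = card {p, q}" using assms(1)[of B] B(1) C(1) assms(3) by auto
  ultimately have "B = {p, q}" by (intro card_subset_eq) auto
  with B C show ?thesis by auto
qed

section \<open>Diagrams\<close>

text \<open>The vertex set \<open>X \<union> Y'\<close> that labels the matrix entry in row \<open>X\<close> and column \<open>Y\<close>.\<close>

definition row_union :: "nat set \<Rightarrow> nat set \<Rightarrow> vertex set" where
  "row_union X Y = Upper ` X \<union> Lower ` Y"

lemma Upper_in_row_union [simp]: "Upper x \<in> row_union X Y \<longleftrightarrow> x \<in> X"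
  and Lower_in_row_union [simp]: "Lower y \<in> row_union X Y \<longleftrightarrow> y \<in> Y"
  and Middle_in_row_union [simp]: "Middle y \<notin> row_union X Y"
  by (auto simp: row_union_def)

lemma verts_eq_row_union: "verts m n = row_union {1..m} {1..n}"
  by (simp add: verts_def row_union_def)

lemma row_union_subset_iff: "row_union X Y \<subseteq> row_union X' Y' \<longleftrightarrow> X \<subseteq> X' \<and> Y \<subseteq> Y'"
  by (auto simp: row_union_def)

lemma card_row_union: "finite X \<Longrightarrow> finite Y \<Longrightarrow> card (row_union X Y) = card X + card Y"
  unfolding row_union_def
  by (subst card_Un_disjoint) (auto simp: card_image inj_on_def)

lemma TL_D:
  assumes "a \<in> TL m n"
  shows "partition_on (verts m n) a" "\<And>B. B \<in> a \<Longrightarrow> card B = 2" "planar a"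
  using assms by (auto simp: TL_def)

text \<open>Blocks have two elements, so a union of blocks has \<open>|X| + |Y|\<close> even. Hence the sets of odd size
  never interfere with those of even size in a matrix product.\<close>

lemma even_card_rows:
  assumes "a \<in> TL m n" "block_union a (row_union X Y)"
  shows "even (card X) \<longleftrightarrow> even (card Y)"
proof -
  have "row_union X Y \<subseteq> verts m n"
    using assms block_union_partition[OF TL_D(1)[OF assms(1)]] by blast
  then have "finite X" "finite Y"
    unfolding verts_eq_row_union row_union_subset_iff by (auto intro: finite_subset)
  moreover have "even (card (row_union X Y))"
    using even_card_block_union TL_D(1,2) assms by metis
  ultimately show ?thesis by (simp add: card_row_union)
qed

lemma TL_parity:
  assumes "a \<in> TL m n"
  shows "even m \<longleftrightarrow> even n"
proof -
  have "block_union a (row_union {1..m} {1..n})"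
    using block_union_partition[OF TL_D(1)[OF assms]] partition_onD1[OF TL_D(1)[OF assms]]
    unfolding verts_eq_row_union by blast
  from even_card_rows[OF assms this] show ?thesis by simp
qed

lemma block_of_vertex:
  assumes "a \<in> TL m n" "p \<in> verts m n"
  obtains q where "q \<in> verts m n" "q \<noteq> p" "{p, q} \<in> a"
proof -
  obtain B where B: "B \<in> a" "p \<in> B" using assms partition_onD1[OF TL_D(1)] by blast
  then obtain r s where "B = {r, s}" "r \<noteq> s" using TL_D(2)[OF assms(1)] by (meson card_2_iff)
  have "B \<subseteq> verts m n" using partition_onD1[OF TL_D(1)[OF assms(1)]] B(1) by blast
  show ?thesis
  proof (cases "p = r")
    case True
    with that[of s] \<open>B = {r, s}\<close> \<open>r \<noteq> s\<close> B(1) \<open>B \<subseteq> verts m n\<close> show ?thesis by simp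
  next
    case False
    with B(2) \<open>B = {r, s}\<close> have "p = s" by simp
    with that[of r] \<open>B = {r, s}\<close> \<open>r \<noteq> s\<close> B(1) \<open>B \<subseteq> verts m n\<close> show ?thesis
      by (simp add: insert_commute)
  qed
qed

lemma block_unique:
  assumes "a \<in> TL m n" "{p, q} \<in> a" "{p, r} \<in> a"
  shows "q = r"
proof -
  have "{p, q} = {p, r}"
    using disjointD[OF partition_onD2[OF TL_D(1)[OF assms(1)]] assms(2,3)] by auto
  then show ?thesis by (auto simp: doubleton_eq_iff)
qed

lemma block_verts: "a \<in> TL m n \<Longrightarrow> B \<in> a \<Longrightarrow> B \<subseteq> verts m n"
  using partition_onD1[OF TL_D(1)] by blast

lemma TL_0_0: "TL 0 0 \<subseteq> {TL_id 0}"
  by (auto simp: TL_def TL_id_def verts_def partition_on_empty)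

lemma TL_1_1: "TL 1 1 \<subseteq> {TL_id 1}"
proof
  fix a assume a: "a \<in> TL 1 1"
  have v: "verts 1 1 = {Upper 1, Lower 1}" by (auto simp: verts_def)
  have B: "B = {Upper 1, Lower 1}" if "B \<in> a" for B
    using block_verts[OF a that] TL_D(2)[OF a that] unfolding v by (intro card_subset_eq) auto
  have "a \<noteq> {}" using block_of_vertex[OF a, of "Upper 1"] v by auto
  with B have "a = {{Upper 1, Lower 1}}" by auto
  then show "a \<in> {TL_id 1}" by (simp add: TL_id_def)
qed

section \<open>Unions of blocks of a product\<close>

lemma sym_same_component: "sym (same_component E)"
  unfolding same_component_def by (intro sym_rtrancl) (auto simp: sym_def insert_commute)

lemma equiv_same_component: "equiv V (same_component E \<inter> V \<times> V)"
proof (rule equivI)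
  show "refl_on V (same_component E \<inter> V \<times> V)"
    by (auto simp: refl_on_def same_component_def)
  show "sym (same_component E \<inter> V \<times> V)"
    using sym_same_component by (auto simp: sym_def)
  show "trans (same_component E \<inter> V \<times> V)"
    by (auto simp: trans_def same_component_def)
qed auto

text \<open>Both sides say that \<open>X \<union> Y'\<close> is the set of outer vertices in some union of components of the
  product graph, and \<open>Z\<close> is the set of middle vertices of this union.\<close>

lemma block_union_TL_mult:
  assumes a: "a \<in> TL m n" and b: "b \<in> TL n t" and X: "X \<subseteq> {1..m}" and Y: "Y \<subseteq> {1..t}"
  shows "block_union (TL_mult m t a b) (row_union X Y) \<longleftrightarrow>
    (\<exists>Z \<subseteq> {1..n}. block_union a (row_union X Z) \<and> block_union b (row_union Z Y))"
    (is "?L \<longleftrightarrow> ?R")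
proof -
  let ?E = "product_edges a b"
  let ?V = "verts m t"
  note pa = block_union_partition[OF TL_D(1)[OF a]]
  note pb = block_union_partition[OF TL_D(1)[OF b]]
  have XY: "row_union X Y \<subseteq> ?V"
    using X Y by (simp add: verts_eq_row_union row_union_subset_iff)
  have L: "?L \<longleftrightarrow> (\<forall>u \<in> row_union X Y. \<forall>v \<in> ?V. (u, v) \<in> same_component ?E \<longrightarrow> v \<in> row_union X Y)"
    unfolding TL_mult_def block_union_quotient[OF equiv_same_component]
    using XY by blast
  show ?thesis
  proof
    assume ?R
    then obtain Z where "block_union a (row_union X Z)" "block_union b (row_union Z Y)" by blast
    then have Za: "\<And>B. B \<in> a \<Longrightarrow> B \<subseteq> row_union X Z \<or> B \<inter> row_union X Z = {}"
      and Zb: "\<And>B. B \<in> b \<Longrightarrow> B \<subseteq> row_union Z Y \<or> B \<inter> row_union Z Y = {}"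
      unfolding pa pb by simp_all
    (* No edge of the product graph leaves W, so W contains the component of each of its vertices. *)
    define W where "W = row_union X Y \<union> Middle ` Z"
    have Wa: "lower_to_middle p \<in> W \<longleftrightarrow> p \<in> row_union X Z" if "p \<in> verts m n" for p
      using that by (cases p) (auto simp: W_def verts_eq_row_union)
    have Wb: "upper_to_middle p \<in> W \<longleftrightarrow> p \<in> row_union Z Y" if "p \<in> verts n t" for p
      using that by (cases p) (auto simp: W_def verts_eq_row_union)
    have step: "v \<in> W" if "u \<in> W" and uv: "{u, v} \<in> ?E" for u v
    proof -
      consider B where "B \<in> a" "{u, v} = lower_to_middle ` B"
        | B where "B \<in> b" "{u, v} = upper_to_middle ` B"
        using uv unfolding product_edges_def by blast
      then show ?thesis
      proof cases
        case 1
        then obtain p q where "p \<in> B" "q \<in> B" "u = lower_to_middle p" "v = lower_to_middle q"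
          by (metis imageE insertI1 insertI2)
        then show ?thesis
          using Za[OF 1(1)] block_verts[OF a 1(1)] Wa \<open>u \<in> W\<close> by blast
      next
        case 2
        then obtain p q where "p \<in> B" "q \<in> B" "u = upper_to_middle p" "v = upper_to_middle q"
          by (metis imageE insertI1 insertI2)
        then show ?thesis
          using Zb[OF 2(1)] block_verts[OF b 2(1)] Wb \<open>u \<in> W\<close> by blast
      qed
    qed
    have closed: "v \<in> W" if "(u, v) \<in> same_component ?E" "u \<in> W" for u v
      using that unfolding same_component_def by (induction rule: rtrancl_induct) (auto intro: step)
    show ?L
      unfolding L
    proof (intro ballI impI)
      fix u v assume "u \<in> row_union X Y" "v \<in> ?V" "(u, v) \<in> same_component ?E"
      then have "v \<in> W" using closed unfolding W_def by blast
      with \<open>v \<in> ?V\<close> show "v \<in> row_union X Y" by (auto simp: W_def verts_eq_row_union)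
    qed
  next
    assume ?L
    note L = this[unfolded L, rule_format]
    (* Conversely, W is the union of the components meeting the given outer vertices. It has no
       further outer vertices, and its middle vertices provide the witness. *)
    define W where "W = same_component ?E `` row_union X Y"
    have self: "u \<in> W" if "u \<in> row_union X Y" for u
      using that by (auto simp: W_def same_component_def)
    have WV: "v \<in> W \<longleftrightarrow> v \<in> row_union X Y" if "v \<in> ?V" for v
      using that L self unfolding W_def by blast
    have step: "u \<in> W \<longleftrightarrow> v \<in> W" if "{u, v} \<in> ?E" for u v
    proof -
      have "(u, v) \<in> same_component ?E" "(v, u) \<in> same_component ?E"
        using that unfolding same_component_def by (auto intro!: r_into_rtrancl simp: insert_commute)
      then show ?thesis unfolding W_def same_component_def by (auto intro: rtrancl_trans)
    qed
    define Z where "Z = {z \<in> {1..n}. Middle z \<in> W}"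
    have Wa: "lower_to_middle p \<in> W \<longleftrightarrow> p \<in> row_union X Z" if "p \<in> verts m n" for p
      using that WV[of p] by (cases p) (auto simp: Z_def verts_eq_row_union)
    have Wb: "upper_to_middle p \<in> W \<longleftrightarrow> p \<in> row_union Z Y" if "p \<in> verts n t" for p
      using that WV[of p] by (cases p) (auto simp: Z_def verts_eq_row_union)
    have Za: "p \<in> row_union X Z \<longleftrightarrow> q \<in> row_union X Z" if "{p, q} \<in> a" for p q
    proof -
      have "lower_to_middle ` {p, q} \<in> ?E" using that unfolding product_edges_def by blast
      then show ?thesis
        using step[of "lower_to_middle p" "lower_to_middle q"]
          Wa block_verts[OF a that] by simp
    qed
    have Zb: "p \<in> row_union Z Y \<longleftrightarrow> q \<in> row_union Z Y" if "{p, q} \<in> b" for p q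
    proof -
      have "upper_to_middle ` {p, q} \<in> ?E" using that unfolding product_edges_def by blast
      then show ?thesis
        using step[of "upper_to_middle p" "upper_to_middle q"]
          Wb block_verts[OF b that] by simp
    qed
    have "Z \<subseteq> {1..n}" by (auto simp: Z_def)
    moreover have "block_union a (row_union X Z)"
      unfolding pa
    proof (intro conjI ballI)
      show "row_union X Z \<subseteq> verts m n"
        using X \<open>Z \<subseteq> {1..n}\<close> by (simp add: verts_eq_row_union row_union_subset_iff)
      fix B assume B: "B \<in> a"
      then obtain p q where "B = {p, q}" using TL_D(2)[OF a] by (meson card_2_iff)
      with Za B show "B \<subseteq> row_union X Z \<or> B \<inter> row_union X Z = {}" by blast
    qed
    moreover have "block_union b (row_union Z Y)"
      unfolding pb
    proof (intro conjI ballI)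
      show "row_union Z Y \<subseteq> verts n t"
        using Y \<open>Z \<subseteq> {1..n}\<close> by (simp add: verts_eq_row_union row_union_subset_iff)
      fix B assume B: "B \<in> b"
      then obtain p q where "B = {p, q}" using TL_D(2)[OF b] by (meson card_2_iff)
      with Zb B show "B \<subseteq> row_union Z Y \<or> B \<inter> row_union Z Y = {}" by blast
    qed
    ultimately show ?R by blast
  qed
qed

lemma block_union_TL_id:
  assumes "X \<subseteq> {1..n}" "Y \<subseteq> {1..n}"
  shows "block_union (TL_id n) (row_union X Y) \<longleftrightarrow> X = Y"
proof
  assume "block_union (TL_id n) (row_union X Y)"
  then obtain C where C: "C \<subseteq> TL_id n" "row_union X Y = \<Union>C" by (rule block_unionE)
  have "Upper i \<in> B \<longleftrightarrow> Lower i \<in> B" if "B \<in> C" for B i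
    using subsetD[OF C(1) that] by (auto simp: TL_id_def)
  then have *: "Upper i \<in> \<Union>C \<longleftrightarrow> Lower i \<in> \<Union>C" for i
    by blast
  have "i \<in> X \<longleftrightarrow> i \<in> Y" for i
    using *[of i] unfolding C(2)[symmetric] by simp
  then show "X = Y" by blast
next
  assume "X = Y"
  then have "row_union X Y = \<Union>{{Upper i, Lower i} | i. i \<in> X}" by (auto simp: row_union_def)
  moreover have "{{Upper i, Lower i} | i. i \<in> X} \<subseteq> TL_id n"
    using assms unfolding TL_id_def by blast
  ultimately show "block_union (TL_id n) (row_union X Y)" by (intro block_unionI)
qed

lemma flip_flip [simp]: "flip (flip p) = p"
  by (cases p) auto

lemma block_union_TL_star:
  "block_union (TL_star a) (row_union X Y) \<longleftrightarrow> block_union a (row_union Y X)"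
proof -
  have "inj flip" by (metis flip_flip injI)
  moreover have "row_union X Y = flip ` row_union Y X"
    by (auto simp: row_union_def image_Un image_image)
  ultimately show ?thesis unfolding TL_star_def by (simp add: block_union_image)
qed

section \<open>A diagram is determined by its even unions of blocks\<close>

text \<open>The hypothesis lets upper-upper and lower-lower blocks be read off from the pairs \<open>{i, j}\<close>. For a
  transversal \<open>x -- y\<close> of \<open>a\<close>, let \<open>b\<close> join the top \<open>x\<close> to \<open>w\<close>, and suppose that \<open>w \<noteq> y\<close>. Then \<open>a\<close>
  joins \<open>w\<close> to some top \<open>u\<close>. The set of the four vertices \<open>x\<close>, \<open>u\<close>, \<open>y\<close>, \<open>w\<close> is a union of blocks of
  \<open>a\<close>, hence of \<open>b\<close>, so \<open>b\<close> joins \<open>u\<close> to \<open>y\<close>. Thus one of \<open>a\<close>, \<open>b\<close> has crossing transversals.\<close>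

lemma blocks_subset:
  assumes a: "a \<in> TL m n" and b: "b \<in> TL m n"
    and eq: "\<And>X Y. X \<subseteq> {1..m} \<Longrightarrow> Y \<subseteq> {1..n} \<Longrightarrow> even (card X) \<Longrightarrow> even (card Y) \<Longrightarrow>
      block_union a (row_union X Y) \<longleftrightarrow> block_union b (row_union X Y)"
  shows "a \<subseteq> b"
proof -
  have two: "block_union c {p, q} \<longleftrightarrow> {p, q} \<in> c" if "c \<in> TL m n" "p \<noteq> q" for c and p q :: vertex
  proof
    assume "block_union c {p, q}"
    then show "{p, q} \<in> c" using block_union_of_size_two[OF TL_D(2)[OF that(1)]] that(2) by blast
  next
    assume "{p, q} \<in> c"
    then show "block_union c {p, q}" by (intro block_unionI[of "{{p, q}}"]) simp_all
  qed
  have upper: "{Upper i, Upper j} \<in> a \<longleftrightarrow> {Upper i, Upper j} \<in> b"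
    if "i \<in> {1..m}" "j \<in> {1..m}" "i \<noteq> j" for i j
    using eq[of "{i, j}" "{}"] two[OF a] two[OF b] that by (simp add: row_union_def)
  have lower: "{Lower i, Lower j} \<in> a \<longleftrightarrow> {Lower i, Lower j} \<in> b"
    if "i \<in> {1..n}" "j \<in> {1..n}" "i \<noteq> j" for i j
    using eq[of "{}" "{i, j}"] two[OF a] two[OF b] that by (simp add: row_union_def)
  have transversal: "{Upper x, Lower y} \<in> b" if xy: "{Upper x, Lower y} \<in> a" for x y
  proof -
    have mem: "x \<in> {1..m}" "y \<in> {1..n}"
      using block_verts[OF a xy] by (auto simp: verts_eq_row_union)
    obtain q where q: "q \<in> verts m n" "q \<noteq> Upper x" "{Upper x, q} \<in> b"
      using block_of_vertex[OF b, of "Upper x"] mem by (auto simp: verts_eq_row_union)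
    (* The partner of x in b is a lower vertex: otherwise a would have the same upper block. *)
    have "q \<noteq> Upper j" for j
    proof
      assume j: "q = Upper j"
      then have "j \<in> {1..m}" "x \<noteq> j" using q by (auto simp: verts_eq_row_union)
      with upper[of x j] mem q(3) j have "{Upper x, Upper j} \<in> a" by simp
      with block_unique[OF a xy] show False by blast
    qed
    then obtain w where qw: "q = Lower w" and w: "w \<in> {1..n}"
      using q(1) by (cases q) (auto simp: verts_eq_row_union)
    have xw: "{Upper x, Lower w} \<in> b" using q qw by simp
    show ?thesis
    proof (cases "w = y")
      case True
      then show ?thesis using xw by simp
    next
      case False
      obtain r where r: "r \<in> verts m n" "r \<noteq> Lower w" "{Lower w, r} \<in> a"
        using block_of_vertex[OF a, of "Lower w"] w by (auto simp: verts_eq_row_union)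
      (* In the same way, the partner of w in a is an upper vertex. *)
      have "r \<noteq> Lower j" for j
      proof
        assume j: "r = Lower j"
        then have "j \<in> {1..n}" "w \<noteq> j" using r by (auto simp: verts_eq_row_union)
        with lower[of w j] w r(3) j have "{Lower w, Lower j} \<in> b" by simp
        moreover have "{Lower w, Upper x} \<in> b" using xw by (simp add: insert_commute)
        ultimately show False using block_unique[OF b] by blast
      qed
      then obtain u where ru: "r = Upper u" and u: "u \<in> {1..m}"
        using r(1) by (cases r) (auto simp: verts_eq_row_union)
      have uw: "{Upper u, Lower w} \<in> a" using r ru by (simp add: insert_commute)
      have "u \<noteq> x" using uw xy False block_unique[OF a, of "Upper x"] by blast
      let ?U = "row_union {x, u} {y, w}"
      have "?U = \<Union>{{Upper x, Lower y}, {Upper u, Lower w}}" by (auto simp: row_union_def)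
      then have "block_union a ?U" by (rule block_unionI[rotated]) (use xy uw in simp)
      then have U: "block_union b ?U"
        using eq[of "{x, u}" "{y, w}"] mem u w False \<open>u \<noteq> x\<close> by simp
      have "block_union b {Upper u, Lower y}"
      proof -
        have rest: "{Upper u, Lower y} = ?U - {Upper x, Lower w}"
          using False \<open>u \<noteq> x\<close> by (auto simp: row_union_def)
        have "B \<subseteq> {Upper u, Lower y} \<or> B \<inter> {Upper u, Lower y} = {}" if B: "B \<in> b" for B
        proof (cases "B = {Upper x, Lower w}")
          case True
          then show ?thesis using False \<open>u \<noteq> x\<close> by auto
        next
          case B': False
          then have "B \<inter> {Upper x, Lower w} = {}"
            by (rule disjointD[OF partition_onD2[OF TL_D(1)[OF b]] B xw])
          moreover have "B \<subseteq> ?U \<or> B \<inter> ?U = {}"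
            using U B unfolding block_union_partition[OF TL_D(1)[OF b]] by blast
          ultimately show ?thesis unfolding rest by blast
        qed
        moreover have "{Upper u, Lower y} \<subseteq> verts m n"
          using mem u by (simp add: verts_eq_row_union)
        ultimately show ?thesis unfolding block_union_partition[OF TL_D(1)[OF b]] by blast
      qed
      then have uy: "{Upper u, Lower y} \<in> b" using two[OF b] by blast
      show ?thesis
      proof (cases "x < u")
        case True
        with planar_transversals_order[OF TL_D(3)[OF a] xy uw]
          planar_transversals_order[OF TL_D(3)[OF b] xw uy] False show ?thesis by simp
      next
        case False
        with planar_transversals_order[OF TL_D(3)[OF a] uw xy]
          planar_transversals_order[OF TL_D(3)[OF b] uy xw] \<open>u \<noteq> x\<close> \<open>w \<noteq> y\<close>
        show ?thesis by simp
      qed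
    qed
  qed
  show ?thesis
  proof
    fix B assume B: "B \<in> a"
    then obtain p q where pq: "B = {p, q}" "p \<noteq> q" using TL_D(2)[OF a] by (meson card_2_iff)
    have v: "p \<in> verts m n" "q \<in> verts m n" using block_verts[OF a B] pq by auto
    show "B \<in> b"
      using B v upper lower transversal unfolding pq(1)
      by (cases p; cases q) (use pq(2) in \<open>auto simp: verts_eq_row_union insert_commute\<close>)
  qed
qed

section \<open>Even matrices\<close>

definition even_subsets :: "nat \<Rightarrow> nat set set" where
  "even_subsets n = {X. X \<subseteq> {1..n} \<and> even (card X)}"

lemma even_dim_eq_card: "even_dim n = card (even_subsets n)"
  by (simp add: even_dim_def even_subsets_def)

lemma even_dim_0 [simp]: "even_dim 0 = 1"
  by (simp add: even_dim_def cong: conj_cong)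

text \<open>A nonempty finite set has as many subsets of even as of odd size.\<close>

lemma even_dim_pos:
  assumes "n \<ge> 1"
  shows "even_dim n = 2 ^ (n - 1)"
proof -
  let ?o = "{X. X \<subseteq> {1..n} \<and> odd (card X)}"
  have "{} \<subset> {1..n}" using assms by auto
  from card_subsupersets_even_odd[OF _ this] have "even_dim n = card ?o"
    by (simp add: even_dim_def)
  moreover have "card (Pow {1..n}) = even_dim n + card ?o"
    unfolding even_dim_def
    by (subst card_Un_disjoint[symmetric]) (auto intro!: arg_cong[where f=card])
  ultimately have "2 * even_dim n = 2 ^ n" by (simp add: card_Pow)
  with assms show ?thesis by (cases n) auto
qed

lemma even_dim_eq_imp:
  assumes "even_dim m = even_dim n"
  shows "m = n \<or> {m, n} = {0, 1}"
proof -
  have S: "even_dim (Suc k) = 2 ^ k" for k using even_dim_pos[of "Suc k"] by simp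
  have one: "2 ^ k = Suc 0 \<longleftrightarrow> k = 0" "Suc 0 = 2 ^ k \<longleftrightarrow> k = 0" for k by (cases k; simp)+
  show ?thesis
    using assms by (cases m; cases n) (auto simp: S one)
qed

lemma bij_betw_pick:
  assumes "finite S"
  shows "bij_betw (pick S) {..<card S} S"
proof -
  have inj: "inj_on (pick S) {..<card S}"
  proof (rule inj_onI)
    fix i j assume "i \<in> {..<card S}" "j \<in> {..<card S}" "pick S i = pick S j"
    then show "i = j" using card_pick_le by (metis lessThan_iff)
  qed
  moreover have "pick S ` {..<card S} \<subseteq> S" using pick_in_set_le by auto
  ultimately have "pick S ` {..<card S} = S"
    using assms by (simp add: card_image card_subset_eq)
  with inj show ?thesis unfolding bij_betw_def by blast
qed

text \<open>Submatrices pick rows in increasing order of their indices, so this is the set that labels row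
  \<open>i\<close> of an even matrix.\<close>

definition nth_even :: "(nat \<Rightarrow> nat \<Rightarrow> nat set) \<Rightarrow> nat \<Rightarrow> nat \<Rightarrow> nat set" where
  "nth_even e n i = e n (pick (even_indices e n) i)"

lemma bij_betw_even_indices:
  assumes "subset_order e"
  shows "bij_betw (e n) (even_indices e n) (even_subsets n)"
proof -
  have b: "bij_betw (e n) {..<2 ^ n} (Pow {1..n})" using assms by (simp add: subset_order_def)
  have "e n ` even_indices e n = even_subsets n"
  proof
    show "e n ` even_indices e n \<subseteq> even_subsets n"
      using bij_betwE[OF b] by (auto simp: even_indices_def even_subsets_def)
    show "even_subsets n \<subseteq> e n ` even_indices e n"
    proof
      fix X assume X: "X \<in> even_subsets n"
      then have "X \<in> e n ` {..<2 ^ n}"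
        using bij_betw_imp_surj_on[OF b] by (simp add: even_subsets_def)
      then obtain i where "i < 2 ^ n" "X = e n i" by blast
      with X show "X \<in> e n ` even_indices e n"
        by (intro image_eqI[of _ _ i]) (simp_all add: even_indices_def even_subsets_def)
    qed
  qed
  then show ?thesis
    by (intro bij_betw_subset[OF b]) (auto simp: even_indices_def)
qed

lemma card_even_indices: "subset_order e \<Longrightarrow> card (even_indices e n) = even_dim n"
  using bij_betw_same_card[OF bij_betw_even_indices] by (simp add: even_dim_eq_card)

lemma bij_betw_nth_even:
  assumes "subset_order e"
  shows "bij_betw (nth_even e n) {..<even_dim n} (even_subsets n)"
proof -
  have "finite (even_indices e n)" by (simp add: even_indices_def)
  from bij_betw_trans[OF bij_betw_pick[OF this] bij_betw_even_indices[OF assms]]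
  show ?thesis by (simp add: nth_even_def[abs_def] comp_def card_even_indices[OF assms])
qed

lemma TL_even_mat_eq:
  assumes "subset_order e"
  shows "(TL_even_mat e m n a :: 'k :: semiring_1 mat) = mat (even_dim m) (even_dim n)
    (\<lambda>(i, j). if block_union a (row_union (nth_even e m i) (nth_even e n j)) then 1 else 0)"
proof -
  have c: "card {i. i < 2 ^ k \<and> i \<in> even_indices e k} = even_dim k" for k
    using card_even_indices[OF assms, of k]
    by (simp add: even_indices_def conj_commute cong: conj_cong)
  have p: "pick (even_indices e k) i < 2 ^ k" if "i < even_dim k" for i k
    using pick_in_set_le[of i "even_indices e k"] that card_even_indices[OF assms, of k]
    by (simp add: even_indices_def)
  show ?thesis
    unfolding TL_even_mat_def submatrix_def
    by (rule eq_matI)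
       (auto simp: TL_mat_def c p nth_even_def block_union_def row_union_def)
qed

lemma sum_zero_one_idempotent:
  assumes "(1 :: 'k :: semiring_1) + 1 = 1" "finite A"
  shows "(\<Sum>z \<in> A. if P z then 1 else (0 :: 'k)) = (if \<exists>z \<in> A. P z then 1 else 0)"
  using assms(2) by induction (use assms(1) in auto)

context
  fixes e :: "nat \<Rightarrow> nat \<Rightarrow> nat set"
  assumes ord: "subset_order e"
begin

lemma nth_even_in: "i < even_dim n \<Longrightarrow> nth_even e n i \<subseteq> {1..n} \<and> even (card (nth_even e n i))"
  using bij_betwE[OF bij_betw_nth_even[OF ord, of n]] by (auto simp: even_subsets_def)

lemma ex_nth_even:
  assumes "X \<subseteq> {1..n}" "even (card X)"
  obtains i where "i < even_dim n" "nth_even e n i = X"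
proof -
  have "X \<in> nth_even e n ` {..<even_dim n}"
    using assms bij_betw_imp_surj_on[OF bij_betw_nth_even[OF ord, of n]]
    by (simp add: even_subsets_def)
  with that show ?thesis by blast
qed

lemma TL_even_mat_carrier:
  "(TL_even_mat e m n a :: 'k :: semiring_1 mat) \<in> carrier_mat (even_dim m) (even_dim n)"
  by (simp add: TL_even_mat_eq[OF ord])

lemma TL_even_mat_id: "(TL_even_mat e n n (TL_id n) :: 'k :: semiring_1 mat) = 1\<^sub>m (even_dim n)"
proof (rule eq_matI)
  fix i j assume "i < dim_row (1\<^sub>m (even_dim n) :: 'k mat)" "j < dim_col (1\<^sub>m (even_dim n) :: 'k mat)"
  then have ij: "i < even_dim n" "j < even_dim n" by simp_all
  then have "nth_even e n i = nth_even e n j \<longleftrightarrow> i = j"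
    using bij_betw_imp_inj_on[OF bij_betw_nth_even[OF ord, of n]] by (auto dest: inj_onD)
  moreover have "block_union (TL_id n) (row_union (nth_even e n i) (nth_even e n j))
      \<longleftrightarrow> nth_even e n i = nth_even e n j"
    using ij nth_even_in by (intro block_union_TL_id) blast+
  ultimately show "TL_even_mat e n n (TL_id n) $$ (i, j) = (1\<^sub>m (even_dim n) :: 'k mat) $$ (i, j)"
    using ij by (simp add: TL_even_mat_eq[OF ord])
qed (simp_all add: TL_even_mat_eq[OF ord])

lemma TL_even_mat_mult:
  assumes idem: "(1 :: 'k :: semiring_1) + 1 = 1" and a: "a \<in> TL m n" and b: "b \<in> TL n t"
  shows "(TL_even_mat e m t (TL_mult m t a b) :: 'k mat) = TL_even_mat e m n a * TL_even_mat e n t b"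
proof (rule eq_matI)
  fix i j
  assume "i < dim_row (TL_even_mat e m n a * TL_even_mat e n t b :: 'k mat)"
    and "j < dim_col (TL_even_mat e m n a * TL_even_mat e n t b :: 'k mat)"
  then have i: "i < even_dim m" and j: "j < even_dim t" by (simp_all add: TL_even_mat_eq[OF ord])
  let ?X = "nth_even e m i" and ?Y = "nth_even e t j"
  let ?P = "\<lambda>Z. block_union a (row_union ?X Z) \<and> block_union b (row_union Z ?Y)"
  have "(TL_even_mat e m n a * TL_even_mat e n t b :: 'k mat) $$ (i, j)
      = (\<Sum>k \<in> {0..<even_dim n}. if ?P (nth_even e n k) then 1 else 0)"
    using i j by (simp add: TL_even_mat_eq[OF ord] scalar_prod_def) (intro sum.cong; simp)
  also have "\<dots> = (if \<exists>k \<in> {0..<even_dim n}. ?P (nth_even e n k) then 1 else 0)"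
    by (rule sum_zero_one_idempotent[OF idem]) simp
  also have "(\<exists>k \<in> {0..<even_dim n}. ?P (nth_even e n k)) \<longleftrightarrow> (\<exists>Z \<subseteq> {1..n}. ?P Z)"
  proof
    assume "\<exists>Z \<subseteq> {1..n}. ?P Z"
    then obtain Z where Z: "Z \<subseteq> {1..n}" "?P Z" by blast
    then have "even (card Z)" using even_card_rows[OF a, of ?X Z] nth_even_in[OF i] by blast
    then obtain k where "k < even_dim n" "nth_even e n k = Z" using Z ex_nth_even by metis
    with Z show "\<exists>k \<in> {0..<even_dim n}. ?P (nth_even e n k)" by (intro bexI[of _ k]) auto
  next
    assume "\<exists>k \<in> {0..<even_dim n}. ?P (nth_even e n k)"
    then show "\<exists>Z \<subseteq> {1..n}. ?P Z" using nth_even_in by (metis atLeastLessThan_iff)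
  qed
  also have "\<dots> \<longleftrightarrow> block_union (TL_mult m t a b) (row_union ?X ?Y)"
    using block_union_TL_mult[OF a b] nth_even_in[OF i] nth_even_in[OF j] by simp
  finally show "(TL_even_mat e m t (TL_mult m t a b) :: 'k mat) $$ (i, j)
      = (TL_even_mat e m n a * TL_even_mat e n t b) $$ (i, j)"
    using i j by (simp add: TL_even_mat_eq[OF ord])
qed (simp_all add: TL_even_mat_eq[OF ord])

lemma TL_even_mat_star:
  "(TL_even_mat e n m (TL_star a) :: 'k :: semiring_1 mat) = transpose_mat (TL_even_mat e m n a)"
  by (rule eq_matI) (auto simp: TL_even_mat_eq[OF ord] block_union_TL_star)

lemma TL_even_mat_inj:
  assumes a: "a \<in> TL m n" and b: "b \<in> TL m n"
    and eq: "(TL_even_mat e m n a :: 'k :: semiring_1 mat) = TL_even_mat e m n b"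
  shows "a = b"
proof -
  have *: "block_union a (row_union X Y) \<longleftrightarrow> block_union b (row_union X Y)"
    if XY: "X \<subseteq> {1..m}" "Y \<subseteq> {1..n}" "even (card X)" "even (card Y)" for X Y
  proof -
    obtain i where i: "i < even_dim m" "nth_even e m i = X" using XY ex_nth_even by metis
    obtain j where j: "j < even_dim n" "nth_even e n j = Y" using XY ex_nth_even by metis
    from eq have "(TL_even_mat e m n a :: 'k mat) $$ (i, j) = TL_even_mat e m n b $$ (i, j)" by simp
    with i j show ?thesis by (auto simp: TL_even_mat_eq[OF ord] split: if_splits)
  qed
  from blocks_subset[OF a b *] blocks_subset[OF b a *[symmetric]] show ?thesis by blast
qed

text \<open>The sizes of the matrices determine \<open>m\<close> and \<open>n\<close> up to confusing 0 with 1. Since \<open>TL m n\<close> is empty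
  unless \<open>m + n\<close> is even, \<open>m\<close> and \<open>n\<close> can only be confused together.\<close>

lemma TL_even_mat_eq_imp:
  assumes a: "a \<in> TL m n" and b: "b \<in> TL k l"
    and eq: "(TL_even_mat e m n a :: 'k :: semiring_1 mat) = TL_even_mat e k l b"
  shows "(m, n, a) = (k, l, b) \<or> {(m, n, a), (k, l, b)} = {(0, 0, TL_id 0), (1, 1, TL_id 1)}"
proof -
  have dims: "even_dim m = even_dim k" "even_dim n = even_dim l"
    using arg_cong[OF eq, of dim_row] arg_cong[OF eq, of dim_col]
    by (simp_all add: TL_even_mat_eq[OF ord])
  note mk = even_dim_eq_imp[OF dims(1)] and nl = even_dim_eq_imp[OF dims(2)]
  have "m = k \<and> n = l \<or> m = 0 \<and> n = 0 \<and> k = 1 \<and> l = 1 \<or> m = 1 \<and> n = 1 \<and> k = 0 \<and> l = 0"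
    using mk nl TL_parity[OF a] TL_parity[OF b] by (auto simp: doubleton_eq_iff)
  then consider "m = k" "n = l" | "m = 0" "n = 0" "k = 1" "l = 1" | "m = 1" "n = 1" "k = 0" "l = 0"
    by blast
  then show ?thesis
  proof cases
    case 1
    with TL_even_mat_inj[OF a] b eq show ?thesis by blast
  next
    case 2
    with a b TL_0_0 TL_1_1 have "a = TL_id 0" "b = TL_id 1" by blast+
    with 2 show ?thesis by simp
  next
    case 3
    with a b TL_0_0 TL_1_1 have "a = TL_id 1" "b = TL_id 0" by blast+
    with 3 show ?thesis by (simp add: insert_commute)
  qed
qed

end

theorem theorem6p1:
  fixes e :: "nat \<Rightarrow> nat \<Rightarrow> nat set"
    and \<Phi> :: "nat \<Rightarrow> nat \<Rightarrow> diagram \<Rightarrow> 'k :: semiring_1 mat"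
  assumes idem: "(1 :: 'k) + 1 = 1"
    and ord: "subset_order e"
    and Phi: "\<Phi> = TL_even_mat e"
  shows
    "cat_representation TL_cat mat_cat even_dim \<Phi> \<and>
     involutive_rep TL_cat mat_cat \<Phi> \<and>
     (\<forall>S. 0 \<notin> S \<or> 1 \<notin> S \<longrightarrow> faithful_rep (full_subcat TL_cat S) even_dim \<Phi>) \<and>
     (\<forall>m n. even_dim m = even_dim n \<longrightarrow> m = n \<or> {m, n} = {0, 1}) \<and>
     (\<forall>m n k l. \<forall>a \<in> TL m n. \<forall>b \<in> TL k l. \<Phi> m n a = \<Phi> k l b \<longrightarrow>
        (m, n, a) = (k, l, b) \<or>
        {(m, n, a), (k, l, b)} = {(0, 0, TL_id 0), (1, 1, TL_id 1)}) \<and>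
     (\<forall>n \<ge> 1.
        \<Phi> n n \<in> hom (TL_monoid n) (ring_mat TYPE('k) (2 ^ (n - 1)) ()) \<and>
        \<Phi> n n (one (TL_monoid n)) = one (ring_mat TYPE('k) (2 ^ (n - 1)) ()) \<and>
        inj_on (\<Phi> n n) (carrier (TL_monoid n)) \<and>
        (\<forall>a \<in> carrier (TL_monoid n). \<Phi> n n (TL_star a) = transpose_mat (\<Phi> n n a)))"
proof (intro conjI)
  note mult = TL_even_mat_mult[OF ord idem]
  note faithful = TL_even_mat_eq_imp[OF ord, where 'k = 'k]
  show "cat_representation TL_cat mat_cat even_dim \<Phi>"
    by (simp add: cat_representation_def TL_cat_def mat_cat_def Phi mult
      TL_even_mat_carrier[OF ord] TL_even_mat_id[OF ord])
  show "involutive_rep TL_cat mat_cat \<Phi>"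
    by (simp add: involutive_rep_def TL_cat_def mat_cat_def Phi TL_even_mat_star[OF ord])
  show "\<forall>m n. even_dim m = even_dim n \<longrightarrow> m = n \<or> {m, n} = {0, 1}"
    using even_dim_eq_imp by blast
  show "\<forall>m n k l. \<forall>a \<in> TL m n. \<forall>b \<in> TL k l. \<Phi> m n a = \<Phi> k l b \<longrightarrow>
        (m, n, a) = (k, l, b) \<or> {(m, n, a), (k, l, b)} = {(0, 0, TL_id 0), (1, 1, TL_id 1)}"
    unfolding Phi by (intro allI ballI impI) (rule faithful)
  show "\<forall>S. 0 \<notin> S \<or> 1 \<notin> S \<longrightarrow> faithful_rep (full_subcat TL_cat S) even_dim \<Phi>"
  proof (intro allI impI)
    fix S :: "nat set" assume S: "0 \<notin> S \<or> 1 \<notin> S"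
    have "inj_on even_dim S"
      using S even_dim_eq_imp by (fastforce simp: inj_on_def doubleton_eq_iff)
    moreover have "inj_on (\<lambda>(x, y, f). \<Phi> x y f) {(x, y, f). x \<in> S \<and> y \<in> S \<and> f \<in> TL x y}"
    proof (rule inj_onI)
      fix p q
      assume p: "p \<in> {(x, y, f). x \<in> S \<and> y \<in> S \<and> f \<in> TL x y}"
        and q: "q \<in> {(x, y, f). x \<in> S \<and> y \<in> S \<and> f \<in> TL x y}"
        and eq: "(\<lambda>(x, y, f). \<Phi> x y f) p = (\<lambda>(x, y, f). \<Phi> x y f) q"
      obtain m n a where mna: "p = (m, n, a)" by (rule prod_cases3)
      obtain k l b where klb: "q = (k, l, b)" by (rule prod_cases3)
      from p q eq have "p = q \<or> {p, q} = {(0, 0, TL_id 0), (1, 1, TL_id 1)}"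
        using faithful[of a m n b k l] unfolding mna klb by (simp add: Phi)
      with p q S show "p = q" by (auto simp: doubleton_eq_iff)
    qed
    ultimately show "faithful_rep (full_subcat TL_cat S) even_dim \<Phi>"
      by (simp add: faithful_rep_def full_subcat_def TL_cat_def)
  qed
  show "\<forall>n \<ge> 1.
        \<Phi> n n \<in> hom (TL_monoid n) (ring_mat TYPE('k) (2 ^ (n - 1)) ()) \<and>
        \<Phi> n n (one (TL_monoid n)) = one (ring_mat TYPE('k) (2 ^ (n - 1)) ()) \<and>
        inj_on (\<Phi> n n) (carrier (TL_monoid n)) \<and>
        (\<forall>a \<in> carrier (TL_monoid n). \<Phi> n n (TL_star a) = transpose_mat (\<Phi> n n a))"
  proof (intro allI impI conjI)
    fix n :: nat assume "1 \<le> n"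
    note dim = even_dim_pos[OF this]
    show "\<Phi> n n \<in> hom (TL_monoid n) (ring_mat TYPE('k) (2 ^ (n - 1)) ())"
      using TL_even_mat_carrier[OF ord, of n n, where 'k = 'k]
      by (auto simp: hom_def TL_monoid_def ring_mat_def Phi mult dim)
    show "\<Phi> n n (one (TL_monoid n)) = one (ring_mat TYPE('k) (2 ^ (n - 1)) ())"
      by (simp add: TL_monoid_def ring_mat_def Phi TL_even_mat_id[OF ord] dim)
    show "inj_on (\<Phi> n n) (carrier (TL_monoid n))"
      using TL_even_mat_inj[OF ord] by (auto simp: inj_on_def TL_monoid_def Phi)
    show "\<forall>a \<in> carrier (TL_monoid n). \<Phi> n n (TL_star a) = transpose_mat (\<Phi> n n a)"
      by (simp add: Phi TL_even_mat_star[OF ord])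
  qed
qed

end
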